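(* Let $n$ be a positive integer. Let either $(\lambda_1,\ldots,\lambda_n)$ be a partition and $k\ge\lambda_1$ an integer, or $(\lambda_1,\ldots,\lambda_n)$ be a half-partition and $k\ge\lambda_1$ a half-integer. Then $$\prod_{i=1}^n\bigl(x_i^{1/2}+\bar{x}_i^{1/2}\bigr)\; s_{(k+\lambda_1,\ldots,k+\lambda_n,k-\lambda_n,\ldots,k-\lambda_1)}(x_1,\ldots,x_n,\bar{x}_1,\ldots,\bar{x}_n)$$ $$=\mathit{so}^{\mathrm{odd}}_{(\lambda_1,\ldots,\lambda_n)}(x_1,\ldots,x_n)\; o^{\mathrm{even}}_{(\lambda_1+1/2,\ldots,\lambda_n+1/2)}(x_1,\ldots,x_n).$$
   Context: A half-integer is an odd integer divided by 2. A partition (respectively half-partition) is a tuple $(\lambda_1,\ldots,\lambda_n)$ whose entries are all nonnegative integers (respectively all positive half-integers) in weakly decreasing order; zero entries of a partition are kept explicitly. The $x_i$ are indeterminates, $\bar{x}=x^{-1}$, and half-integer powers are powers of a formal square root $x_i^{1/2}$, with $\bar{x}_i^{1/2}=(x_i^{1/2})^{-1}$. For a partition $\mu=(\mu_1,\ldots,\mu_N)$, the Schur polynomial is $$s_\mu(y_1,\ldots,y_N)=\frac{\det_{1\le i,j\le N}\bigl(y_i^{\mu_j+N-j}\bigr)}{\prod_{1\le i<j\le N}(y_i-y_j)}.$$ It is a symmetric polynomial in $y_1,\ldots,y_N$, which can be evaluated at arbitrary arguments. For a partition or half-partition $\mu=(\mu_1,\ldots,\mu_N)$, the odd orthogonal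 character is $$\mathit{so}^{\mathrm{odd}}_\mu(y_1,\ldots,y_N)=\frac{\det_{1\le i,j\le N}\bigl(y_i^{\mu_j+N-j+1/2}-\bar{y}_i^{\mu_j+N-j+1/2}\bigr)}{\prod_{i=1}^N\bigl(y_i^{1/2}-\bar{y}_i^{1/2}\bigr)\prod_{1\le i<j\le N}(y_i+\bar{y}_i-y_j-\bar{y}_j)},$$ and the even orthogonal character is $$o^{\mathrm{even}}_\mu(y_1,\ldots,y_N)=\frac{\det_{1\le i,j\le N}\bigl(y_i^{\mu_j+N-j}+\bar{y}_i^{\mu_j+N-j}\bigr)}{(1+\delta_{\mu_N,0})\prod_{1\le i<j\le N}(y_i+\bar{y}_i-y_j-\bar{y}_j)},$$ where $\delta$ is the Kronecker delta. *)

theory Defs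
  imports
    "HOL-Library.Poly_Mapping"
    "HOL-Computational_Algebra.Fraction_Field"
    "Jordan_Normal_Form.Determinant"
begin

subsection \<open>Partitions and half-partitions\<close>

text \<open>Entries are rational, so that partitions and half-partitions share one type.
  Tuples are lists, hence indexed from 0, and zero entries are significant.\<close>

definition half_integer :: "rat \<Rightarrow> bool" where
  "half_integer a \<longleftrightarrow> (\<exists>m :: int. odd m \<and> a = of_int m / 2)"

definition is_partition :: "rat list \<Rightarrow> bool" where
  "is_partition \<mu> \<longleftrightarrow> sorted_wrt (\<ge>) \<mu> \<and> (\<forall>a\<in>set \<mu>. a \<in> \<nat>)"

definition is_half_partition :: "rat list \<Rightarrow> bool" where
  "is_half_partition \<mu> \<longleftrightarrow> sorted_wrt (\<ge>) \<mu> \<and> (\<forall>a\<in>set \<mu>. half_integer a \<and> 0 < a)"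

subsection \<open>Schur polynomials and orthogonal characters\<close>

text \<open>Since rows and columns are counted from 0, the exponent shift \<open>N - j\<close> of the usual formulas,
  where \<open>1 \<le> j \<le> N\<close>, becomes \<open>N - Suc j\<close>, where \<open>j < N\<close>.

  \<open>schur \<mu> y\<close> is the Schur polynomial of a partition \<open>\<mu>\<close> evaluated at \<open>length \<mu>\<close> pairwise distinct
  elements \<open>y\<close> of a field, where the bialternant quotient is the value of the polynomial.
  The floor only converts the integral exponent to an integer.\<close>

definition schur :: "rat list \<Rightarrow> 'a::field list \<Rightarrow> 'a" where
  "schur \<mu> y = (let N = length \<mu> in
     det (mat N N (\<lambda>(i, j). (y ! i) ^ nat \<lfloor>\<mu> ! j + of_nat (N - Suc j)\<rfloor>)) /
     (\<Prod>j<N. \<Prod>i<j. y ! i - y ! j))"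

text \<open>If \<open>r\<close> is the chosen square root of \<open>y\<close> and \<open>a\<close> is an integer or a half-integer, then
  \<open>root_pow r a\<close> is the power of \<open>y\<close> with exponent \<open>a\<close>. The floor again acts on an integer.\<close>

definition root_pow :: "'a::field \<Rightarrow> rat \<Rightarrow> 'a" where
  "root_pow r a = r powi \<lfloor>2 * a\<rfloor>"

text \<open>The argument \<open>r\<close> of the two characters lists the square roots of the variables,
  so \<open>y\<^sub>i\<close> is \<open>(r ! i)\<^sup>2 = root_pow (r ! i) 1\<close>.\<close>

definition so_odd :: "rat list \<Rightarrow> 'a::field list \<Rightarrow> 'a" where
  "so_odd \<mu> r = (let N = length \<mu> in
     det (mat N N (\<lambda>(i, j).
       root_pow (r ! i) (\<mu> ! j + of_nat (N - Suc j) + 1/2)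
       - root_pow (inverse (r ! i)) (\<mu> ! j + of_nat (N - Suc j) + 1/2))) /
     ((\<Prod>i<N. r ! i - inverse (r ! i)) *
      (\<Prod>j<N. \<Prod>i<j. (r ! i)\<^sup>2 + inverse ((r ! i)\<^sup>2) - (r ! j)\<^sup>2 - inverse ((r ! j)\<^sup>2))))"

definition o_even :: "rat list \<Rightarrow> 'a::field list \<Rightarrow> 'a" where
  "o_even \<mu> r = (let N = length \<mu> in
     det (mat N N (\<lambda>(i, j).
       root_pow (r ! i) (\<mu> ! j + of_nat (N - Suc j))
       + root_pow (inverse (r ! i)) (\<mu> ! j + of_nat (N - Suc j)))) /
     ((1 + (if \<mu> ! (N - 1) = 0 then 1 else 0)) *
      (\<Prod>j<N. \<Prod>i<j. (r ! i)\<^sup>2 + inverse ((r ! i)\<^sup>2) - (r ! j)\<^sup>2 - inverse ((r ! j)\<^sup>2))))"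

subsection \<open>The indeterminates\<close>

text \<open>The field of fractions of the polynomial ring over the rationals in the indeterminates
  \<open>sqrt_xvar i\<close>; the variables \<open>xvar i\<close> are their squares.\<close>

type_synonym ratfun = "((nat \<Rightarrow>\<^sub>0 nat) \<Rightarrow>\<^sub>0 rat) fract"

definition sqrt_xvar :: "nat \<Rightarrow> ratfun" where
  "sqrt_xvar i = Fract (Poly_Mapping.single (Poly_Mapping.single i 1) 1) 1"

definition xvar :: "nat \<Rightarrow> ratfun" where
  "xvar i = (sqrt_xvar i)\<^sup>2"

text \<open>At these arguments all the denominators above are nonzero, so the convention \<open>a / 0 = 0\<close>
  plays no role.\<close>

lemma xvar_eq: "xvar i = Fract (Poly_Mapping.single (Poly_Mapping.single i 2) 1) 1"
  by (simp add: xvar_def sqrt_xvar_def power2_eq_square mult_single numeral_2_eq_2 flip: single_add)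

lemma sqrt_xvar_nonzero [simp]: "sqrt_xvar i \<noteq> 0"
  by (auto simp: sqrt_xvar_def Zero_fract_def eq_fract dest!: arg_cong[where f = Poly_Mapping.keys])

lemma xvar_nonzero [simp]: "xvar i \<noteq> 0"
  by (simp add: xvar_def)

lemma xvar_eq_iff [simp]: "xvar i = xvar j \<longleftrightarrow> i = j"
  by (auto simp: xvar_eq eq_fract dest!: arg_cong[where f = Poly_Mapping.keys])

lemma xvar_mult_neq_1: "xvar i * xvar j \<noteq> 1"
proof
  assume "xvar i * xvar j = 1"
  hence "Poly_Mapping.single (Poly_Mapping.single i (2::nat) + Poly_Mapping.single j 2) (1::rat) = 1"
    by (simp add: xvar_eq One_fract_def eq_fract mult_single)
  hence "Poly_Mapping.single i (2::nat) + Poly_Mapping.single j 2 = 0"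
    by (auto simp flip: single_one dest!: arg_cong[where f = Poly_Mapping.keys])
  hence "Poly_Mapping.lookup (Poly_Mapping.single i (2::nat) + Poly_Mapping.single j 2) i = 0"
    by simp
  thus False
    by (simp add: lookup_add)
qed

lemma distinct_xvar: "distinct (map xvar [0..<n] @ map (\<lambda>i. inverse (xvar i)) [0..<n])"
proof -
  have "xvar i \<noteq> inverse (xvar j)" for i j
    using xvar_mult_neq_1[of i j] by (metis xvar_nonzero right_inverse mult.commute)
  thus ?thesis
    by (auto simp: distinct_map inj_on_def)
qed

lemma sqrt_xvar_minus_inverse_nonzero: "sqrt_xvar i - inverse (sqrt_xvar i) \<noteq> 0"
proof
  assume "sqrt_xvar i - inverse (sqrt_xvar i) = 0"
  hence "xvar i = 1"
    by (simp add: xvar_def power2_eq_square field_simps)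
  thus False
    using xvar_mult_neq_1[of i i] by simp
qed

lemma xvar_plus_inverse_diff_nonzero:
  assumes "i \<noteq> j"
  shows "xvar i + inverse (xvar i) - xvar j - inverse (xvar j) \<noteq> 0"
proof -
  have "xvar i + inverse (xvar i) - xvar j - inverse (xvar j) = (xvar i - xvar j) * (xvar i * xvar j - 1) / (xvar i * xvar j)"
    by (simp add: field_simps)
  thus ?thesis
    using assms xvar_mult_neq_1[of i j] by simp
qed

end

theory Submission
  imports Defs
begin

text \<open>With \<open>a\<^sub>j = \<lambda>\<^sub>j + n - j + 1/2\<close> and \<open>c = k + n - 1/2\<close>, the exponents in the numerator of the
  Schur polynomial are \<open>c + a\<^sub>1, \<dots>, c + a\<^sub>n, c - a\<^sub>n, \<dots>, c - a\<^sub>1\<close>. The row factors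
  \<open>x\<^sub>i\<^sup>c\<close> and \<open>x\<^sub>i\<^sup>-\<^sup>c\<close> cancel, and reversing the last \<open>n\<close> columns turns the matrix into the block
  matrix with rows \<open>(A, B)\<close> and \<open>(B, A)\<close>, where \<open>A = (x\<^sub>i ^ a\<^sub>j)\<close> and \<open>B = (x\<^sub>i ^ -a\<^sub>j)\<close>. Its
  determinant \<open>det (A - B) * det (A + B)\<close> is the product of the numerators of the two characters.
  In the denominator, the four factors belonging to a pair \<open>i < j\<close> multiply to minus the
  square of \<open>x\<^sub>i + 1/x\<^sub>i - x\<^sub>j - 1/x\<^sub>j\<close>, and these signs cancel that of the column reversal.\<close>

subsection \<open>Determinants\<close>

lemma det_scale_rows:
  fixes f :: "nat \<Rightarrow> nat \<Rightarrow> 'a::comm_ring_1"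
  shows "det (mat n n (\<lambda>(i, j). d i * f i j)) = (\<Prod>i<n. d i) * det (mat n n (\<lambda>(i, j). f i j))"
proof -
  have "(\<Prod>i = 0..<n. mat n n (\<lambda>(i, j). d i * f i j) $$ (i, p i))
      = (\<Prod>i<n. d i) * (\<Prod>i = 0..<n. mat n n (\<lambda>(i, j). f i j) $$ (i, p i))"
    if "p permutes {0..<n}" for p
    using permutes_in_image[OF that]
    by (simp add: prod.distrib flip: atLeast0LessThan)
  thus ?thesis
    by (simp add: det_def sum_distrib_left mult.left_commute cong: sum.cong_simp)
qed

definition reversal_mat :: "nat \<Rightarrow> 'a::comm_ring_1 mat" where
  "reversal_mat n = mat n n (\<lambda>(i, j). if i + j = n - 1 then 1 else 0)"

lemma reversal_mat_carrier [simp]: "reversal_mat n \<in> carrier_mat n n"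
  by (simp add: reversal_mat_def)

text \<open>Laplace expansion along the top row leaves a single cofactor, of sign
  \<open>(- 1) ^ n\<close>, which is the new factor \<open>j = n\<close> of the product. The sign is
  kept as a product over pairs so that it matches the one in
  \<open>vandermonde_prod_inverse\<close>.\<close>

lemma det_reversal_mat: "det (reversal_mat n :: 'a::comm_ring_1 mat) = (\<Prod>j<n. \<Prod>i<j. - 1)"
proof (induction n)
  case 0
  show ?case
    by (simp add: reversal_mat_def)
next
  case (Suc n)
  let ?J = "reversal_mat (Suc n) :: 'a mat"
  have "det ?J = (\<Sum>j<Suc n. ?J $$ (0, j) * cofactor ?J 0 j)"
    by (rule laplace_expansion_row) auto
  also have "\<dots> = (\<Sum>j<Suc n. if j = n then cofactor ?J 0 n else 0)"
    by (rule sum.cong) (auto simp: reversal_mat_def)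
  also have "\<dots> = cofactor ?J 0 n"
    by simp
  also have "mat_delete ?J 0 n = reversal_mat n"
    by (rule eq_matI) (auto simp: reversal_mat_def mat_delete_def)
  hence "cofactor ?J 0 n = (- 1) ^ n * det (reversal_mat n)"
    by (simp add: cofactor_def)
  finally show ?case
    by (simp add: Suc)
qed

lemma mult_reversal_mat:
  assumes "A \<in> carrier_mat m n"
  shows "A * reversal_mat n = mat m n (\<lambda>(i, j). A $$ (i, n - Suc j))"
proof (rule eq_matI)
  fix i j assume "i < dim_row (mat m n (\<lambda>(i, j). A $$ (i, n - Suc j)))"
    and "j < dim_col (mat m n (\<lambda>(i, j). A $$ (i, n - Suc j)))"
  hence ij: "i < m" "j < n"
    by auto
  have "(A * reversal_mat n) $$ (i, j) = (\<Sum>l = 0..<n. A $$ (i, l) * reversal_mat n $$ (l, j))"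
    using ij assms by (simp add: scalar_prod_def reversal_mat_def)
  also have "\<dots> = (\<Sum>l = 0..<n. if l = n - Suc j then A $$ (i, n - Suc j) else 0)"
    using ij by (intro sum.cong) (auto simp: reversal_mat_def)
  also have "\<dots> = A $$ (i, n - Suc j)"
    using ij by simp
  finally show "(A * reversal_mat n) $$ (i, j) = mat m n (\<lambda>(i, j). A $$ (i, n - Suc j)) $$ (i, j)"
    using ij by simp
qed (use assms in \<open>auto simp: reversal_mat_def\<close>)

text \<open>Adding the second block row to the first and then subtracting the first block column
  from the second makes the matrix block lower triangular. These operations are multiplications by
  \<open>?U\<close> and \<open>?V\<close>, of determinant 1.\<close>

lemma det_block_circulant:
  fixes A B :: "'a::idom mat"
  assumes A: "A \<in> carrier_mat n n" and B: "B \<in> carrier_mat n n"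
  shows "det (four_block_mat A B B A) = det (A + B) * det (A - B)"
proof -
  let ?U = "four_block_mat (1\<^sub>m n) (1\<^sub>m n) (0\<^sub>m n n) (1\<^sub>m n) :: 'a mat"
  let ?V = "four_block_mat (1\<^sub>m n) (- 1\<^sub>m n) (0\<^sub>m n n) (1\<^sub>m n) :: 'a mat"
  let ?M = "four_block_mat A B B A"
  have UM: "?U * ?M = four_block_mat (A + B) (B + A) B A"
    using A B by (subst mult_four_block_mat[of _ n n _ n _ n _ _ n _ n]) auto
  have "B + A + - (A + B) = 0\<^sub>m n n" "A + - B = A - B"
    using A B by auto
  hence UMV: "?U * ?M * ?V = four_block_mat (A + B) (0\<^sub>m n n) B (A - B)"
    unfolding UM using A B
    by (subst mult_four_block_mat[of _ n n _ n _ n _ _ n _ n])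
       (auto intro!: cong_four_block_mat simp: add.commute)
  have "det ?U = 1" "det ?V = 1"
    by (subst det_four_block_mat_lower_left_zero[of _ n _ n]; simp)+
  moreover have U: "?U \<in> carrier_mat (n + n) (n + n)" and V: "?V \<in> carrier_mat (n + n) (n + n)"
    and M: "?M \<in> carrier_mat (n + n) (n + n)"
    using A by auto
  ultimately have "det ?M = det (?U * ?M * ?V)"
    by (simp add: det_mult[OF mult_carrier_mat[OF U M] V] det_mult[OF U M])
  also have "\<dots> = det (A + B) * det (A - B)"
    unfolding UMV using A B by (intro det_four_block_mat_upper_right_zero) auto
  finally show ?thesis .
qed

subsection \<open>The two sides of the quotient\<close>

text \<open>The index square consists of the diagonal and of the mirror pairs (i, j), (j, i).
  Applied to the mixed differences x_i - 1/x_j, this attaches two of them to each pair i <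
  j.\<close>

lemma prod_square_split:
  fixes f :: "nat \<Rightarrow> nat \<Rightarrow> 'a::comm_monoid_mult"
  shows "(\<Prod>j<n. \<Prod>i<n. f i j) = (\<Prod>i<n. f i i) * (\<Prod>j<n. \<Prod>i<j. f i j * f j i)"
  by (induction n) (simp_all add: prod.distrib ac_simps)

lemma prod_lessThan_add:
  fixes f :: "nat \<Rightarrow> 'a::comm_monoid_mult"
  shows "(\<Prod>i<m + n. f i) = (\<Prod>i<m. f i) * (\<Prod>i<n. f (m + i))"
  by (induction n) (simp_all add: ac_simps)

lemma vandermonde_prod_append:
  fixes u v :: "'a::comm_ring_1 list"
  assumes "length u = m" "length v = n"
  shows "(\<Prod>j<m + n. \<Prod>i<j. (u @ v) ! i - (u @ v) ! j)
    = (\<Prod>j<m. \<Prod>i<j. u ! i - u ! j) * (\<Prod>j<n. \<Prod>i<m. u ! i - v ! j) * (\<Prod>j<n. \<Prod>i<j. v ! i - v ! j)"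
  using assms by (simp add: prod_lessThan_add nth_append prod.distrib mult.assoc)

text \<open>The diagonal mixed differences x_i - 1/x_i are differences of squares of r_i and 1/r_i.
  Their factors are the prefactor of the theorem and the linear part of the denominator of
  \<open>so_odd\<close>.\<close>

lemma vandermonde_prod_inverse:
  fixes r :: "nat \<Rightarrow> 'a::field"
  assumes nz: "\<And>i. i < n \<Longrightarrow> r i \<noteq> 0"
  defines "y \<equiv> map (\<lambda>i. (r i)\<^sup>2) [0..<n] @ map (\<lambda>i. inverse ((r i)\<^sup>2)) [0..<n]"
  shows "(\<Prod>j<n + n. \<Prod>i<j. y ! i - y ! j)
    = (\<Prod>j<n. \<Prod>i<j. - 1) * (\<Prod>i<n. r i + inverse (r i)) * (\<Prod>i<n. r i - inverse (r i)) *
      (\<Prod>j<n. \<Prod>i<j. (r i)\<^sup>2 + inverse ((r i)\<^sup>2) - (r j)\<^sup>2 - inverse ((r j)\<^sup>2))\<^sup>2"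
    (is "_ = _ * _ * _ * (\<Prod>j<n. \<Prod>i<j. ?D i j)\<^sup>2")
proof -
  let ?x = "\<lambda>i. (r i)\<^sup>2"
  have pair: "(?x i - ?x j) * ((?x i - inverse (?x j)) * (?x j - inverse (?x i))) *
      (inverse (?x i) - inverse (?x j)) = - 1 * (?D i j * ?D i j)" if "i < n" "j < n" for i j
  proof -
    have *: "(a - b) * ((a - inverse b) * (b - inverse a)) * (inverse a - inverse b)
        = - 1 * ((a + inverse a - b - inverse b) * (a + inverse a - b - inverse b))"
      if "a \<noteq> 0" "b \<noteq> 0" for a b :: 'a
    proof -
      have "a - inverse b = (a * b - 1) / b" "b - inverse a = (a * b - 1) / a"
        "inverse a - inverse b = - (a - b) / (a * b)"
        "a + inverse a - b - inverse b = (a - b) * (a * b - 1) / (a * b)"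
        using that by (simp_all add: field_simps)
      \<comment> \<open>Here \<open>u\<close> and \<open>v\<close> stand for a - b and a * b - 1,
        the only numerators involved. Keeping them opaque leaves an identity between
        monomials.\<close>
      moreover have "u * (v / b * (v / a)) * (- u / (a * b))
          = - 1 * (u * v / (a * b) * (u * v / (a * b)))" for u v
        using that by (simp add: field_simps)
      ultimately show ?thesis
        by (simp only:)
    qed
    show ?thesis
      using nz that by (intro *) auto
  qed
  have diag: "?x i - inverse (?x i) = (r i + inverse (r i)) * (r i - inverse (r i))" if "i < n" for i
    using nz[OF that] by (simp add: field_simps power2_eq_square)
  have "(\<Prod>j<n + n. \<Prod>i<j. y ! i - y ! j)
    = (\<Prod>j<n. \<Prod>i<j. ?x i - ?x j) * (\<Prod>j<n. \<Prod>i<n. ?x i - inverse (?x j)) *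
      (\<Prod>j<n. \<Prod>i<j. inverse (?x i) - inverse (?x j))"
    unfolding y_def by (subst vandermonde_prod_append) auto
  also have "\<dots> = (\<Prod>i<n. ?x i - inverse (?x i)) *
      (\<Prod>j<n. \<Prod>i<j. (?x i - ?x j) * ((?x i - inverse (?x j)) * (?x j - inverse (?x i))) *
        (inverse (?x i) - inverse (?x j)))"
    by (subst prod_square_split) (simp add: prod.distrib ac_simps)
  also have "\<dots> = (\<Prod>i<n. (r i + inverse (r i)) * (r i - inverse (r i))) *
      (\<Prod>j<n. \<Prod>i<j. - 1 * (?D i j * ?D i j))"
    by (intro arg_cong2[of _ _ _ _ "(*)"] prod.cong refl diag pair) auto
  finally show ?thesis
    unfolding prod.distrib power2_eq_square by (simp only: ac_simps)
qed

text \<open>Powers are taken of the square roots, so that all exponents are integers: in the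
  application, \<open>c\<close> and \<open>e j\<close> are twice the \<open>c\<close> and
  \<open>a\<^sub>j\<close> of the overview, and \<open>s\<close> lists the square roots of all 2n
  arguments.\<close>

lemma det_centred_exponents:
  fixes r :: "nat \<Rightarrow> 'a::field" and e :: "nat \<Rightarrow> int" and c :: int
  assumes nz: "\<And>i. i < n \<Longrightarrow> r i \<noteq> 0"
  defines "s \<equiv> \<lambda>i. if i < n then r i else inverse (r (i - n))"
  defines "E \<equiv> \<lambda>j. if j < n then e j else - e (n + n - Suc j)"
  shows "det (mat (n + n) (n + n) (\<lambda>(i, j). s i powi (c + E j)))
    = (\<Prod>j<n. \<Prod>i<j. - 1) *
      det (mat n n (\<lambda>(i, j). r i powi e j + inverse (r i) powi e j)) *
      det (mat n n (\<lambda>(i, j). r i powi e j - inverse (r i) powi e j))"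
proof -
  define A where "A = mat n n (\<lambda>(i, j). r i powi e j)"
  define B where "B = mat n n (\<lambda>(i, j). inverse (r i) powi e j)"
  have AB [simp]: "A \<in> carrier_mat n n" "B \<in> carrier_mat n n"
    by (simp_all add: A_def B_def)
  have s: "s i \<noteq> 0" if "i < n + n" for i
    using nz that by (simp add: s_def)
  have "det (mat (n + n) (n + n) (\<lambda>(i, j). s i powi (c + E j)))
      = det (mat (n + n) (n + n) (\<lambda>(i, j). s i powi c * s i powi E j))"
    using s by (intro arg_cong[of _ _ det] cong_mat) (auto simp: power_int_add)
  also have "\<dots> = (\<Prod>i<n + n. s i powi c) * det (mat (n + n) (n + n) (\<lambda>(i, j). s i powi E j))"
    by (rule det_scale_rows)
  also have "(\<Prod>i<n + n. s i powi c) = (\<Prod>i<n. r i powi c * inverse (r i) powi c)"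
    by (simp add: prod_lessThan_add s_def prod.distrib)
  also have "\<dots> = 1"
    using nz by (intro prod.neutral) (simp flip: power_int_mult_distrib)
  \<comment> \<open>Column n + j carries the exponent - e (n - 1 - j). The sign turns r into its
    inverse and back, so the right half is \<open>B\<close> above \<open>A\<close>, each with its
    columns reversed.\<close>
  also have "mat (n + n) (n + n) (\<lambda>(i, j). s i powi E j)
      = four_block_mat A (B * reversal_mat n) B (A * reversal_mat n)"
    unfolding mult_reversal_mat[OF AB(1)] mult_reversal_mat[OF AB(2)]
    by (rule eq_matI)
       (auto simp: A_def B_def s_def E_def power_int_minus power_int_inverse Suc_diff_Suc
          intro!: arg_cong[of _ _ e])
  also have "\<dots> = four_block_mat A B B A * four_block_mat (1\<^sub>m n) (0\<^sub>m n n) (0\<^sub>m n n) (reversal_mat n)"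
  proof -
    have "A * reversal_mat n \<in> carrier_mat n n" "B * reversal_mat n \<in> carrier_mat n n"
      by (rule mult_carrier_mat[OF _ reversal_mat_carrier], rule AB)+
    thus ?thesis
      by (subst mult_four_block_mat[OF AB(1,2,2,1) one_carrier_mat zero_carrier_mat zero_carrier_mat
            reversal_mat_carrier]) (simp add: AB[THEN right_mult_one_mat]
              AB[THEN right_mult_zero_mat] AB[THEN right_add_zero_mat])
  qed
  also have "det \<dots> = det (four_block_mat A B B A) * det (reversal_mat n)"
    by (subst det_mult[of _ "n + n"], simp, simp, subst det_four_block_mat_upper_right_zero[of _ n _ n]) auto
  also have "det (four_block_mat A B B A) = det (A + B) * det (A - B)"
    by (rule det_block_circulant[OF AB])
  also have "A + B = mat n n (\<lambda>(i, j). r i powi e j + inverse (r i) powi e j)"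
    by (rule eq_matI) (auto simp: A_def B_def)
  also have "A - B = mat n n (\<lambda>(i, j). r i powi e j - inverse (r i) powi e j)"
    by (rule eq_matI) (auto simp: A_def B_def)
  finally show ?thesis
    by (simp add: det_reversal_mat mult_ac)
qed

subsection \<open>The factorization\<close>

text \<open>Here \<open>a\<close> is a part of \<open>lam\<close>. As \<open>a\<close> and
  \<open>k\<close> are of the same type, k + a and k - a are integers, and 0 \<le> a \<le> k makes
  them nonnegative; hence neither the floor nor \<open>nat\<close> changes the exponents. The factor
  2 passes from powers of x to powers of its square root.\<close>

lemma schur_exponents:
  fixes a k :: rat
  assumes "a \<in> \<nat> \<and> k \<in> \<int> \<or> half_integer a \<and> half_integer k" "a \<le> k" "0 \<le> a" "j < n"
  defines "e \<equiv> \<lfloor>2 * (a + of_nat (n - Suc j) + 1/2)\<rfloor>" and "c \<equiv> \<lfloor>2 * k\<rfloor> + 2 * int n - 1"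
  shows "2 * int (nat \<lfloor>k + a + of_nat (n + n - Suc j)\<rfloor>) = c + e"
    and "2 * int (nat \<lfloor>k - a + of_nat j\<rfloor>) = c - e"
proof -
  \<comment> \<open>The numbers 2a and 2k are both even or both odd.\<close>
  obtain p q where pq: "2 * a = of_int p" "2 * k = of_int q" "even (p + q)"
  proof -
    have "\<exists>p q. 2 * a = of_int p \<and> 2 * k = of_int q \<and> even (p + q)"
      using assms(1)
    proof
      assume "a \<in> \<nat> \<and> k \<in> \<int>"
      then obtain p q where "a = of_nat p" "k = of_int q"
        by (metis Nats_cases Ints_cases)
      thus ?thesis
        by (intro exI[of _ "2 * int p"] exI[of _ "2 * q"]) simp
    next
      assume "half_integer a \<and> half_integer k"
      thus ?thesis
        unfolding half_integer_def by force
    qed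
    thus ?thesis
      using that by blast
  qed
  \<comment> \<open>Thus u = k + a and u - p = k - a.\<close>
  then obtain u where u: "p + q = 2 * u"
    by blast
  have a: "a = of_int p / 2" and k: "k = of_int (2 * u - p) / 2"
    using pq u by (simp_all add: field_simps eq_diff_eq flip: of_int_add)
  have "p \<ge> 0"
    using \<open>0 \<le> a\<close> by (simp add: a)
  have "u \<ge> p"
    using \<open>a \<le> k\<close> unfolding a k by (simp add: divide_right_mono field_simps flip: of_int_mult)
  have e: "e = p + 2 * int (n - Suc j) + 1"
  proof -
    have "2 * (a + of_nat (n - Suc j) + 1/2) = of_int (p + 2 * int (n - Suc j) + 1)"
      by (simp add: a)
    thus ?thesis
      unfolding e_def by (simp only: floor_of_int)
  qed
  have c: "c = 2 * u - p + 2 * int n - 1"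
    unfolding c_def pq(2) using u by simp
  have "k + a + of_nat (n + n - Suc j) = of_int (u + int (n + n - Suc j))"
    by (simp add: a k field_simps)
  hence "\<lfloor>k + a + of_nat (n + n - Suc j)\<rfloor> = u + int (n + n - Suc j)"
    by (simp only: floor_of_int)
  thus "2 * int (nat \<lfloor>k + a + of_nat (n + n - Suc j)\<rfloor>) = c + e"
    using \<open>p \<ge> 0\<close> \<open>u \<ge> p\<close> \<open>j < n\<close> by (simp add: e c of_nat_diff)
  have "k - a + of_nat j = of_int (u - p + int j)"
    by (simp add: a k field_simps)
  hence "\<lfloor>k - a + of_nat j\<rfloor> = u - p + int j"
    by (simp only: floor_of_int)
  thus "2 * int (nat \<lfloor>k - a + of_nat j\<rfloor>) = c - e"
    using \<open>u \<ge> p\<close> \<open>j < n\<close> by (simp add: e c of_nat_diff)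
qed

text \<open>Working with arbitrary field elements \<open>r i\<close> separates the algebra from the
  field of fractions.\<close>

lemma schur_factorization:
  fixes r :: "nat \<Rightarrow> 'a::field"
  assumes "n > 0" and len: "length lam = n"
    and lam: "is_partition lam \<and> k \<in> \<int> \<or> is_half_partition lam \<and> half_integer k"
    and "k \<ge> lam ! 0"
    and nz: "\<And>i. i < n \<Longrightarrow> r i \<noteq> 0" and sum_nz: "\<And>i. i < n \<Longrightarrow> r i + inverse (r i) \<noteq> 0"
  shows "(\<Prod>i<n. r i + inverse (r i)) *
      schur (map (\<lambda>a. k + a) lam @ map (\<lambda>a. k - a) (rev lam))
            (map (\<lambda>i. (r i)\<^sup>2) [0..<n] @ map (\<lambda>i. inverse ((r i)\<^sup>2)) [0..<n])
    = so_odd lam (map r [0..<n]) * o_even (map (\<lambda>a. a + 1/2) lam) (map r [0..<n])"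
proof -
  define e where "e = (\<lambda>j. \<lfloor>2 * (lam ! j + of_nat (n - Suc j) + 1/2)\<rfloor>)"
  define c where "c = \<lfloor>2 * k\<rfloor> + 2 * int n - 1"
  define s where "s = (\<lambda>i. if i < n then r i else inverse (r (i - n)))"
  define E where "E = (\<lambda>j. if j < n then e j else - e (n + n - Suc j))"
  define \<mu> where "\<mu> = map (\<lambda>a. k + a) lam @ map (\<lambda>a. k - a) (rev lam)"
  define y where "y = map (\<lambda>i. (r i)\<^sup>2) [0..<n] @ map (\<lambda>i. inverse ((r i)\<^sup>2)) [0..<n]"
  define P where "P = (\<Prod>i<n. r i + inverse (r i))"
  define S where "S = (\<Prod>j<n. \<Prod>i<j. - 1 :: 'a)"
  have "P \<noteq> 0" "S \<noteq> 0"
    using sum_nz by (simp_all add: P_def S_def)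

  have "sorted_wrt (\<ge>) lam"
    using lam by (auto simp: is_partition_def is_half_partition_def)
  hence le: "lam ! j \<le> k" if "j < n" for j
    using that len \<open>k \<ge> lam ! 0\<close> by (cases "j = 0") (force simp: sorted_wrt_iff_nth_less)+
  have ge: "0 \<le> lam ! j" if "j < n" for j
  proof -
    have "lam ! j \<in> set lam"
      using that len by simp
    thus ?thesis
      using lam by (auto simp: is_partition_def is_half_partition_def Nats_def intro: less_imp_le)
  qed
  have type: "lam ! j \<in> \<nat> \<and> k \<in> \<int> \<or> half_integer (lam ! j) \<and> half_integer k" if "j < n" for j
    using that len lam by (auto simp: is_partition_def is_half_partition_def)
  have exp: "2 * int (nat \<lfloor>\<mu> ! j + of_nat (n + n - Suc j)\<rfloor>) = c + E j" if "j < n + n" for j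
  proof (cases "j < n")
    case True
    hence "\<mu> ! j = k + lam ! j" "E j = e j"
      using len by (simp_all add: \<mu>_def nth_append E_def)
    thus ?thesis
      unfolding e_def c_def using schur_exponents(1)[OF type le ge, OF True True True True]
      by (simp only:)
  next
    case False
    \<comment> \<open>The mirror index \<open>l\<close> serves twice: it locates the part of
      \<open>lam\<close> behind the reversed list, and it is the shift N - Suc j for N = 2n.\<close>
    define l where "l = n + n - Suc j"
    have l: "l < n" "rev lam ! (j - n) = lam ! l"
      using False that len by (auto simp: l_def rev_nth intro!: arg_cong[of _ _ "(!) lam"])
    hence "\<mu> ! j = k - lam ! l" "c + E j = c - e l"
      using len False that by (simp_all add: \<mu>_def nth_append E_def l_def)
    thus ?thesis
      unfolding e_def c_def l_def[symmetric]
      using schur_exponents(2)[OF type le ge, OF l(1) l(1) l(1) l(1)] by (simp only:)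
  qed
  have ypow: "y ! i ^ nat \<lfloor>\<mu> ! j + of_nat (n + n - Suc j)\<rfloor> = s i powi (c + E j)"
    if "i < n + n" "j < n + n" for i j
  proof -
    have "y ! i = (s i)\<^sup>2"
      using that by (auto simp: y_def s_def nth_append power_inverse)
    moreover have "2 * int m = int (2 * m)" for m
      by simp
    ultimately have "y ! i ^ m = s i powi (2 * int m)" for m
      by (simp only: power_int_of_nat power_mult)
    thus ?thesis
      using exp[OF that(2)] by simp
  qed
  have num: "det (mat (n + n) (n + n) (\<lambda>(i, j). y ! i ^ nat \<lfloor>\<mu> ! j + of_nat (n + n - Suc j)\<rfloor>))
      = S * det (mat n n (\<lambda>(i, j). r i powi e j + inverse (r i) powi e j)) *
        det (mat n n (\<lambda>(i, j). r i powi e j - inverse (r i) powi e j))"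
  proof -
    have "mat (n + n) (n + n) (\<lambda>(i, j). y ! i ^ nat \<lfloor>\<mu> ! j + of_nat (n + n - Suc j)\<rfloor>)
        = mat (n + n) (n + n) (\<lambda>(i, j). s i powi (c + E j))"
      by (rule cong_mat) (simp_all only: prod.case ypow)
    thus ?thesis
      unfolding s_def E_def S_def using det_centred_exponents[of n r c e, OF nz] by simp
  qed
  let ?D = "\<Prod>j<n. \<Prod>i<j. (r i)\<^sup>2 + inverse ((r i)\<^sup>2) - (r j)\<^sup>2 - inverse ((r j)\<^sup>2)"
  let ?Q = "\<Prod>i<n. r i - inverse (r i)"
  have den: "(\<Prod>j<n + n. \<Prod>i<j. y ! i - y ! j) = S * P * ?Q * ?D\<^sup>2"
    unfolding y_def S_def P_def by (rule vandermonde_prod_inverse) (rule nz)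
  have schur: "schur \<mu> y = S * det (mat n n (\<lambda>(i, j). r i powi e j + inverse (r i) powi e j)) *
      det (mat n n (\<lambda>(i, j). r i powi e j - inverse (r i) powi e j)) / (S * P * ?Q * ?D\<^sup>2)"
  proof -
    have "length \<mu> = n + n"
      using len by (simp add: \<mu>_def)
    thus ?thesis
      unfolding schur_def Let_def num[symmetric] den[symmetric] by simp
  qed
  have odd: "so_odd lam (map r [0..<n])
      = det (mat n n (\<lambda>(i, j). r i powi e j - inverse (r i) powi e j)) / (?Q * ?D)"
    unfolding so_odd_def Let_def len root_pow_def e_def
    by (intro arg_cong2[of _ _ _ _ "(/)"] arg_cong[of _ _ det] arg_cong2[of _ _ _ _ "(*)"]
        cong_mat prod.cong refl) auto
  \<comment> \<open>The last part of the shifted tuple is at least 1/2, so the Kronecker delta in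
    \<open>o_even\<close> is 0.\<close>
  have "lam ! (n - 1) + 1/2 \<noteq> 0"
    using ge[of "n - 1"] \<open>n > 0\<close> by simp
  \<comment> \<open>The 1/2 added to the parts here equals the 1/2 in the exponents of
    \<open>so_odd\<close>, so both characters use the same \<open>e j\<close>.\<close>
  hence even: "o_even (map (\<lambda>a. a + 1/2) lam) (map r [0..<n])
      = det (mat n n (\<lambda>(i, j). r i powi e j + inverse (r i) powi e j)) / ((1 + 0) * ?D)"
    unfolding o_even_def Let_def length_map len root_pow_def e_def
    by (intro arg_cong2[of _ _ _ _ "(/)"] arg_cong[of _ _ det] arg_cong2[of _ _ _ _ "(*)"]
        cong_mat prod.cong refl) (use len \<open>n > 0\<close> in \<open>auto simp: add_ac\<close>)
  \<comment> \<open>Only \<open>P\<close> and \<open>S\<close> are cancelled. The product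
    \<open>?Q * ?D * ?D\<close> remains a denominator on both sides, so even if it vanishes the two
    sides agree, by x / 0 = 0.\<close>
  show ?thesis
    using \<open>P \<noteq> 0\<close> \<open>S \<noteq> 0\<close>
    unfolding P_def[symmetric] \<mu>_def[symmetric] y_def[symmetric] schur odd even
    by (simp add: power2_eq_square mult_ac)
qed

theorem theorem1:
  fixes n :: nat and lam :: "rat list" and k :: rat
  assumes "n > 0" and "length lam = n"
    and "is_partition lam \<and> k \<in> \<int> \<or> is_half_partition lam \<and> half_integer k"
    and "k \<ge> lam ! 0"
  shows "(\<Prod>i<n. sqrt_xvar i + inverse (sqrt_xvar i)) *
      schur (map (\<lambda>a. k + a) lam @ map (\<lambda>a. k - a) (rev lam))
            (map xvar [0..<n] @ map (\<lambda>i. inverse (xvar i)) [0..<n])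
    = so_odd lam (map sqrt_xvar [0..<n]) *
      o_even (map (\<lambda>a. a + 1/2) lam) (map sqrt_xvar [0..<n])"
proof -
  have "sqrt_xvar i + inverse (sqrt_xvar i) \<noteq> 0" for i
  proof
    assume "sqrt_xvar i + inverse (sqrt_xvar i) = 0"
    \<comment> \<open>This would give the square of \<open>xvar i\<close> the value 1.\<close>
    hence "xvar i = - 1"
      by (simp add: xvar_def power2_eq_square add_eq_0_iff field_simps)
    thus False
      using xvar_mult_neq_1[of i i] by simp
  qed
  thus ?thesis
    unfolding xvar_def using assms by (intro schur_factorization) auto
qed

end
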